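(* The group $\mathrm{Aut}(\mathbb{Q}\mathbb{U})$, regarded as a subgroup of $\mathrm{Aut}(\mathbb{U})$, is dense in $\mathrm{Aut}(\mathbb{U})$ in the weak topology.
   Context: $\mathbb{U}$ denotes the Urysohn space: the complete separable metric space, unique up to isometry, that is homogeneous (any isometry between finite subsets extends to an isometry of $\mathbb{U}$ onto itself) and universal (every complete separable metric space embeds isometrically in it). $\mathbb{Q}\mathbb{U}$ denotes the rational Urysohn space: the countable metric space with rational distances, unique up to isometry, such that for every finite subset $A$ and every function $g:A\to\mathbb{Q}$ with $g(a)\ge 0$ and $|g(a)-g(b)|\le d(a,b)\le g(a)+g(b)$ for all $a,b\in A$, there is a point $z$ of the space with $d(z,a)=g(a)$ for all $a\in A$. It is homogeneous (any isometry between finite subsets extends to an isometry of the whole space), and its completion is $\mathbb{U}$; we regard $\mathbb{Q}\mathbb{U}$ as a dense subset of $\mathbb{U}$ in this way. For a metric space $M$, $\mathrm{Aut}(M)$ is the group of all isometries of $M$ onto itself. Every isometry of $\mathbb{Q}\mathbb{U}$ extends uniquely to $\mathbb{U}$, which makes $\mathrm{Aut}(\mathbb{Q}\mathbb{U})$ a subgroup of $\mathrm{Aut}(\mathbb{U})$. The weak topology on $\mathrm{Aut}(\mathbb{U})$ is the one induced by the product topology on $\mathbb{U}^{\mathbb{U}}$ (pointwise convergence). *)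

theory Defs
  imports "HOL-Analysis.Analysis" "HOL-Algebra.Bij" "HOL-Algebra.Coset"
begin

subsection \<open>Isometry groups\<close>

text \<open>
  As in \<^const>\<open>Bij\<close>, maps are extensional, i.e. fixed to be \<^const>\<open>undefined\<close> outside
  the space, so that an isometry is determined by its values on the space.
\<close>

definition isometries :: "'a metric \<Rightarrow> ('a \<Rightarrow> 'a) set"
  where "isometries X =
    {f \<in> Bij (mspace X). \<forall>x\<in>mspace X. \<forall>y\<in>mspace X. mdist X (f x) (f y) = mdist X x y}"

definition Aut :: "'a metric \<Rightarrow> ('a \<Rightarrow> 'a) monoid"
  where "Aut X = BijGroup (mspace X) \<lparr>carrier := isometries X\<rparr>"

definition weak_topology :: "'a metric \<Rightarrow> ('a \<Rightarrow> 'a) topology"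
  where "weak_topology X =
    subtopology (product_topology (\<lambda>_. mtopology_of X) (mspace X)) (carrier (Aut X))"


subsection \<open>The Urysohn space and the rational Urysohn space\<close>

definition homogeneous_metric :: "'a metric \<Rightarrow> bool"
  where "homogeneous_metric X \<longleftrightarrow>
    (\<forall>A B f. finite A \<and> A \<subseteq> mspace X \<and> finite B \<and> B \<subseteq> mspace X \<and> bij_betw f A B \<and>
        (\<forall>x\<in>A. \<forall>y\<in>A. mdist X (f x) (f y) = mdist X x y)
      \<longrightarrow> (\<exists>g\<in>isometries X. \<forall>x\<in>A. g x = f x))"

definition isometrically_embeds :: "'a metric \<Rightarrow> 'b metric \<Rightarrow> bool"
  where "isometrically_embeds X Y \<longleftrightarrow>
    (\<exists>f \<in> mspace X \<rightarrow> mspace Y.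
      \<forall>x\<in>mspace X. \<forall>y\<in>mspace X. mdist Y (f x) (f y) = mdist X x y)"

text \<open>
  A definition cannot quantify over all types. It suffices to quantify over the metric
  spaces whose points are real sequences, since every separable metric space has an isometric
  copy there (send a point to its sequence of distances to a dense sequence);
  lemma \<open>universal_metric_embeds\<close> below confirms that no generality is lost.
\<close>

definition universal_metric :: "'a metric \<Rightarrow> bool"
  where "universal_metric X \<longleftrightarrow>
    (\<forall>Y :: (nat \<Rightarrow> real) metric.
      mcomplete_of Y \<and> separable_space (mtopology_of Y) \<longrightarrow> isometrically_embeds Y X)"

definition urysohn_space :: "'a metric \<Rightarrow> bool"
  where "urysohn_space X \<longleftrightarrow>
    mcomplete_of X \<and> separable_space (mtopology_of X) \<and>
    homogeneous_metric X \<and> universal_metric X"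

definition rational_urysohn_space :: "'a metric \<Rightarrow> bool"
  where "rational_urysohn_space X \<longleftrightarrow>
    countable (mspace X) \<and>
    (\<forall>x\<in>mspace X. \<forall>y\<in>mspace X. mdist X x y \<in> \<rat>) \<and>
    (\<forall>A (g :: 'a \<Rightarrow> real).
      finite A \<and> A \<subseteq> mspace X \<and> (\<forall>a\<in>A. g a \<in> \<rat> \<and> g a \<ge> 0) \<and>
      (\<forall>a\<in>A. \<forall>b\<in>A. \<bar>g a - g b\<bar> \<le> mdist X a b \<and> mdist X a b \<le> g a + g b)
      \<longrightarrow> (\<exists>z\<in>mspace X. \<forall>a\<in>A. mdist X z a = g a))"


subsection \<open>Extending isometries from a dense subset\<close>

text \<open>Well defined for complete \<open>X\<close> and dense \<open>S\<close>, see \<open>ex1_extend_isometry\<close>.\<close>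

definition extend_isometry :: "'a metric \<Rightarrow> 'a set \<Rightarrow> ('a \<Rightarrow> 'a) \<Rightarrow> 'a \<Rightarrow> 'a"
  where "extend_isometry X S f = (THE g. g \<in> isometries X \<and> (\<forall>x\<in>S. g x = f x))"


subsection \<open>Adequacy of the definitions\<close>

lemma isometries_comp:
  assumes "f \<in> isometries X" "g \<in> isometries X"
  shows "compose (mspace X) f g \<in> isometries X"
  using assms by (simp add: isometries_def compose_Bij compose_eq funcset_mem[OF Bij_imp_funcset])

lemma isometries_inv:
  assumes "f \<in> isometries X"
  shows "(\<lambda>x\<in>mspace X. inv_into (mspace X) f x) \<in> isometries X"
proof -
  have b: "bij_betw f (mspace X) (mspace X)" and B: "f \<in> Bij (mspace X)"
    and d: "\<And>x y. x \<in> mspace X \<Longrightarrow> y \<in> mspace X \<Longrightarrow> mdist X (f x) (f y) = mdist X x y"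
    using assms by (auto simp: isometries_def Bij_def)
  have "mdist X (inv_into (mspace X) f x) (inv_into (mspace X) f y) = mdist X x y"
    if "x \<in> mspace X" "y \<in> mspace X" for x y
    using d[of "inv_into (mspace X) f x" "inv_into (mspace X) f y"] that b
    by (metis B Bij_inv_into_mem bij_betw_inv_into_right)
  then show ?thesis
    using restrict_inv_into_Bij[OF B] by (simp add: isometries_def)
qed

lemma subgroup_isometries: "subgroup (isometries X) (BijGroup (mspace X))"
proof
  show "isometries X \<subseteq> carrier (BijGroup (mspace X))"
    by (auto simp: isometries_def BijGroup_def)
next
  fix f g assume *: "f \<in> isometries X" "g \<in> isometries X"
  then have "f \<in> Bij (mspace X)" "g \<in> Bij (mspace X)"
    by (auto simp: isometries_def)
  with isometries_comp[OF *] show "f \<otimes>\<^bsub>BijGroup (mspace X)\<^esub> g \<in> isometries X"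
    by (simp add: BijGroup_def)
next
  show "\<one>\<^bsub>BijGroup (mspace X)\<^esub> \<in> isometries X"
    by (simp add: BijGroup_def isometries_def id_Bij)
next
  fix f assume f: "f \<in> isometries X"
  then have "f \<in> Bij (mspace X)"
    by (auto simp: isometries_def)
  with isometries_inv[OF f] show "inv\<^bsub>BijGroup (mspace X)\<^esub> f \<in> isometries X"
    by (simp add: inv_BijGroup)
qed

lemma group_Aut: "group (Aut X)"
  unfolding Aut_def
  by (rule subgroup.subgroup_is_group[OF subgroup_isometries group_BijGroup])

lemma carrier_Aut [simp]: "carrier (Aut X) = isometries X"
  by (simp add: Aut_def)

lemma topspace_weak_topology: "topspace (weak_topology X) = carrier (Aut X)"
  by (auto simp: weak_topology_def isometries_def Bij_def PiE_def bij_betw_def)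

lemma isometries_continuous:
  assumes "g \<in> isometries X"
  shows "continuous_map (mtopology_of X) (mtopology_of X) g"
proof -
  have "Lipschitz_continuous_map X X g"
    unfolding Lipschitz_continuous_map_def
    using assms by (auto simp: isometries_def dest: Bij_imp_funcset intro!: exI[of _ 1])
  then show ?thesis
    by (rule Lipschitz_continuous_imp_continuous_map)
qed

lemma Hausdorff_mtopology_of: "Hausdorff_space (mtopology_of X)"
  by (simp add: Metric_space.Hausdorff_space_mtopology mtopology_of_def)

lemma continuous_maps_eq_on_dense:
  assumes dense: "mtopology_of X closure_of S = mspace X"
    and "continuous_map (mtopology_of X) Y g" "continuous_map (mtopology_of X) Y h"
    and "Hausdorff_space Y" and "\<And>x. x \<in> S \<Longrightarrow> g x = h x" and "x \<in> mspace X"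
  shows "g x = h x"
  using forall_in_closure_of_eq[of x "mtopology_of X" S Y g h] assms by simp

lemma isometric_extension:
  assumes compl: "mcomplete_of X" and dense: "mtopology_of X closure_of S = mspace X"
    and sub: "S \<subseteq> mspace X" and fS: "f \<in> S \<rightarrow> S"
    and iso: "\<And>x y. x \<in> S \<Longrightarrow> y \<in> S \<Longrightarrow> mdist X (f x) (f y) = mdist X x y"
  obtains g where "continuous_map (mtopology_of X) (mtopology_of X) g"
    "\<And>x. x \<in> S \<Longrightarrow> g x = f x"
    "\<And>x y. x \<in> mspace X \<Longrightarrow> y \<in> mspace X \<Longrightarrow> mdist X (g x) (g y) = mdist X x y"
proof -
  have "Lipschitz_continuous_map (submetric X S) X f"
    unfolding Lipschitz_continuous_map_def using fS sub iso
    by (auto intro!: exI[of _ 1])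
  then obtain g where g: "Lipschitz_continuous_map (submetric X (mspace X)) X g"
    and gf: "\<And>x. x \<in> S \<Longrightarrow> g x = f x"
    using Lipschitz_continuous_map_extends_to_closure_of[OF compl] dense by metis
  then have cont: "continuous_map (mtopology_of X) (mtopology_of X) g"
    using Lipschitz_continuous_imp_continuous_map by fastforce
  then have gX: "g x \<in> mspace X" if "x \<in> mspace X" for x
    using that by (auto simp: continuous_map_def)
  have cd: "continuous_map (mtopology_of X) euclidean (\<lambda>x. mdist X (h x) a)"
    if "continuous_map (mtopology_of X) (mtopology_of X) h" "a \<in> mspace X" for h a
    using that by (intro continuous_map_mdist) auto
  have cid: "continuous_map (mtopology_of X) (mtopology_of X) (\<lambda>x. x)"
    by simp
  have 1: "mdist X (g x) (g y) = mdist X x y" if "x \<in> mspace X" "y \<in> S" for x y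
    by (rule continuous_maps_eq_on_dense[OF dense cd[OF cont] cd[OF cid]])
      (use that sub gX gf iso fS in auto)
  have 2: "mdist X (g y) (g x) = mdist X y x" if "x \<in> mspace X" "y \<in> S" for x y
    using 1[OF that] by (simp add: mdist_commute)
  have "mdist X (g y) (g x) = mdist X y x" if "x \<in> mspace X" "y \<in> mspace X" for x y
    by (rule continuous_maps_eq_on_dense[OF dense cd[OF cont] cd[OF cid]])
      (use that gX 2 in auto)
  with cont gf that show thesis by blast
qed

lemma ex1_extend_isometry:
  assumes compl: "mcomplete_of X" and dense: "mtopology_of X closure_of S = mspace X"
    and sub: "S \<subseteq> mspace X" and f: "f \<in> isometries (submetric X S)"
  shows "\<exists>!g. g \<in> isometries X \<and> (\<forall>x\<in>S. g x = f x)"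
proof (rule ex_ex1I)
  have S: "S \<inter> mspace X = S"
    using sub by blast
  have b: "bij_betw f S S"
    and d: "\<And>x y. x \<in> S \<Longrightarrow> y \<in> S \<Longrightarrow> mdist X (f x) (f y) = mdist X x y"
    using f by (auto simp: isometries_def Bij_def S)
  let ?k = "inv_into S f"
  have kS: "?k x \<in> S" "f (?k x) = x" "?k (f x) = x" if "x \<in> S" for x
    using b that by (auto simp: bij_betw_def inv_into_into f_inv_into_f)
  have kd: "mdist X (?k x) (?k y) = mdist X x y" if "x \<in> S" "y \<in> S" for x y
    using d[of "?k x" "?k y"] kS that by simp
  have fS: "f \<in> S \<rightarrow> S"
    using b by (auto simp: bij_betw_def)
  obtain g where g: "continuous_map (mtopology_of X) (mtopology_of X) g"
    "\<And>x. x \<in> S \<Longrightarrow> g x = f x"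
    "\<And>x y. x \<in> mspace X \<Longrightarrow> y \<in> mspace X \<Longrightarrow> mdist X (g x) (g y) = mdist X x y"
    using isometric_extension[OF compl dense sub fS] d by blast
  obtain h where h: "continuous_map (mtopology_of X) (mtopology_of X) h"
    "\<And>x. x \<in> S \<Longrightarrow> h x = ?k x"
  proof (rule isometric_extension[OF compl dense sub])
    show "?k \<in> S \<rightarrow> S"
      using kS by blast
  qed (use kd in auto)
  have gX: "g x \<in> mspace X" "h x \<in> mspace X" if "x \<in> mspace X" for x
    using that g(1) h(1) by (auto simp: continuous_map_def)
  have gh: "(g \<circ> h) x = id x" if "x \<in> mspace X" for x
    by (rule continuous_maps_eq_on_dense[OF dense continuous_map_compose[OF h(1) g(1)] 
          continuous_map_id Hausdorff_mtopology_of _ that])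
      (use g(2) h(2) kS in simp)
  have hg: "(h \<circ> g) x = id x" if "x \<in> mspace X" for x
    by (rule continuous_maps_eq_on_dense[OF dense continuous_map_compose[OF g(1) h(1)] 
          continuous_map_id Hausdorff_mtopology_of _ that])
      (use g(2) h(2) kS funcset_mem[OF fS] in simp)
  have bg: "bij_betw g (mspace X) (mspace X)"
    using gX gh hg by (intro bij_betw_byWitness[of _ h]) auto
  have "bij_betw (restrict g (mspace X)) (mspace X) (mspace X)"
    using bg by (rule bij_betw_cong[THEN iffD1, rotated]) simp
  then have "restrict g (mspace X) \<in> isometries X"
    using g(3) by (simp add: isometries_def Bij_def)
  moreover have "\<forall>x\<in>S. restrict g (mspace X) x = f x"
    using g(2) sub by auto
  ultimately show "\<exists>g. g \<in> isometries X \<and> (\<forall>x\<in>S. g x = f x)"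
    by blast
next
  fix g h
  assume g: "g \<in> isometries X \<and> (\<forall>x\<in>S. g x = f x)" and h: "h \<in> isometries X \<and> (\<forall>x\<in>S. h x = f x)"
  have "g x = h x" if "x \<in> mspace X" for x
    by (rule continuous_maps_eq_on_dense[OF dense _ _ Hausdorff_mtopology_of _ that])
      (use g h isometries_continuous in auto)
  then show "g = h"
    using g h by (auto simp: isometries_def Bij_def intro: extensionalityI)
qed

lemma extend_isometry:
  assumes "mcomplete_of X" "mtopology_of X closure_of S = mspace X" "S \<subseteq> mspace X"
    "f \<in> isometries (submetric X S)"
  shows "extend_isometry X S f \<in> isometries X"
    and "x \<in> S \<Longrightarrow> extend_isometry X S f x = f x"
  using theI'[OF ex1_extend_isometry[OF assms]] by (auto simp: extend_isometry_def)

lemma extend_isometry_mon: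
  assumes X: "mcomplete_of X" "mtopology_of X closure_of S = mspace X" "S \<subseteq> mspace X"
  shows "extend_isometry X S \<in> mon (Aut (submetric X S)) (Aut X)"
proof -
  have S: "S \<inter> mspace X = S"
    using X by blast
  note ext = extend_isometry[OF X]
  have maps: "f x \<in> S" if "f \<in> isometries (submetric X S)" "x \<in> S" for f x
    using that S by (auto simp: isometries_def Bij_def bij_betw_def)
  have Bij: "f \<in> isometries Z \<Longrightarrow> f \<in> Bij (mspace Z)" for f and Z :: "'a metric"
    by (simp add: isometries_def)
  have mult: "f \<otimes>\<^bsub>Aut Z\<^esub> g = compose (mspace Z) f g"
    if "f \<in> isometries Z" "g \<in> isometries Z" for f g and Z :: "'a metric"
    using that[THEN Bij] by (simp add: Aut_def BijGroup_def)
  have "extend_isometry X S (compose S f g)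
      = compose (mspace X) (extend_isometry X S f) (extend_isometry X S g)"
    if f: "f \<in> isometries (submetric X S)" and g: "g \<in> isometries (submetric X S)" for f g
  proof -
    have c: "compose S f g \<in> isometries (submetric X S)"
      using isometries_comp[OF f g] S by simp
    have "compose (mspace X) (extend_isometry X S f) (extend_isometry X S g) \<in> isometries X"
      by (intro isometries_comp ext f g)
    moreover have "\<forall>x\<in>S. compose (mspace X) (extend_isometry X S f) (extend_isometry X S g) x
        = compose S f g x"
      using X(3) ext(2) f g maps by (auto simp: compose_def)
    ultimately show ?thesis
      using ex1_extend_isometry[OF X c] ext[OF c] by blast
  qed
  moreover have "inj_on (extend_isometry X S) (isometries (submetric X S))"
  proof (rule inj_onI)
    fix f g
    assume fg: "f \<in> isometries (submetric X S)" "g \<in> isometries (submetric X S)"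
      "extend_isometry X S f = extend_isometry X S g"
    then have "f x = g x" if "x \<in> S" for x
      using ext(2) that by metis
    then show "f = g"
      using fg S by (auto simp: isometries_def Bij_def intro: extensionalityI)
  qed
  ultimately show ?thesis
    using ext(1) S by (auto simp: mon_def hom_def mult)
qed

lemma subgroup_extend_isometry:
  assumes "mcomplete_of X" "mtopology_of X closure_of S = mspace X" "S \<subseteq> mspace X"
  shows "subgroup (extend_isometry X S ` carrier (Aut (submetric X S))) (Aut X)"
proof -
  have "group_hom (Aut (submetric X S)) (Aut X) (extend_isometry X S)"
    using extend_isometry_mon[OF assms] group_Aut
    by (auto simp: mon_def intro!: group_hom.intro group_hom_axioms.intro)
  then show ?thesis
    by (rule group_hom.img_is_subgroup)
qed


lemma isometric_copy:
  fixes Y :: "'b metric" and \<phi> :: "'b \<Rightarrow> 'c"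
  assumes inj: "inj_on \<phi> (mspace Y)"
    and compl: "mcomplete_of Y" and sep: "separable_space (mtopology_of Y)"
  obtains Z :: "'c metric"
  where "mspace Z = \<phi> ` mspace Y" "mcomplete_of Z" "separable_space (mtopology_of Z)"
    "\<And>x y. x \<in> mspace Y \<Longrightarrow> y \<in> mspace Y \<Longrightarrow> mdist Z (\<phi> x) (\<phi> y) = mdist Y x y"
proof -
  let ?M = "\<phi> ` mspace Y"
  define \<psi> where "\<psi> = inv_into (mspace Y) \<phi>"
  define d where "d = (\<lambda>a b. mdist Y (\<psi> a) (\<psi> b))"
  have \<psi>\<phi>: "\<psi> (\<phi> x) = x" if "x \<in> mspace Y" for x
    using inj that by (simp add: \<psi>_def)
  interpret Z: Metric_space ?M d
    by unfold_locales (auto simp: d_def \<psi>\<phi> mdist_commute mdist_triangle)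
  interpret YZ: Metric_space12 "mspace Y" "mdist Y" ?M d
    by (simp add: Metric_space12_def Z.Metric_space_axioms)
  have "homeomorphic_map YZ.M1.mtopology Z.mtopology \<phi>"
    by (rule YZ.isometry_imp_homeomorphic_map) (auto simp: d_def \<psi>\<phi>)
  then have hom: "mtopology_of Y homeomorphic_space Z.mtopology"
    and cont: "continuous_map (mtopology_of Y) Z.mtopology \<phi>"
    by (auto simp: mtopology_of_def homeomorphic_map_imp_homeomorphic_space
        homeomorphic_imp_continuous_map)
  have "Z.mcomplete"
    unfolding Z.mcomplete_def
  proof (intro allI impI)
    fix \<sigma> assume \<sigma>: "Z.MCauchy \<sigma>"
    then have r: "\<sigma> n \<in> ?M" for n
      by (auto simp: Z.MCauchy_def)
    then have \<psi>\<sigma>: "\<psi> (\<sigma> n) \<in> mspace Y" "\<phi> (\<psi> (\<sigma> n)) = \<sigma> n" for n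
      using r[of n] \<psi>\<phi> by (metis imageE)+
    have "YZ.M1.MCauchy (\<psi> \<circ> \<sigma>)"
      using \<sigma> \<psi>\<sigma>(1) unfolding Z.MCauchy_def YZ.M1.MCauchy_def by (auto simp: d_def)
    then obtain x where "limitin (mtopology_of Y) (\<psi> \<circ> \<sigma>) x sequentially"
      using compl by (auto simp: mcomplete_of_def mtopology_of_def YZ.M1.mcomplete_def)
    then have "limitin Z.mtopology (\<phi> \<circ> (\<psi> \<circ> \<sigma>)) (\<phi> x) sequentially"
      by (rule continuous_map_limit[OF cont])
    moreover have "\<phi> \<circ> (\<psi> \<circ> \<sigma>) = \<sigma>"
      using \<psi>\<sigma> by auto
    ultimately show "\<exists>x. limitin Z.mtopology \<sigma> x sequentially"
      by auto
  qed
  moreover have "separable_space Z.mtopology"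
    using sep homeomorphic_separable_space[OF hom] by simp
  moreover have "d (\<phi> x) (\<phi> y) = mdist Y x y" if "x \<in> mspace Y" "y \<in> mspace Y" for x y
    using that by (simp add: d_def \<psi>\<phi>)
  ultimately show thesis
    using that[of "metric (?M, d)"] by simp
qed

lemma universal_metric_embeds:
  fixes Y :: "'b metric"
  assumes X: "universal_metric X"
    and compl: "mcomplete_of Y" and sep: "separable_space (mtopology_of Y)"
  shows "isometrically_embeds Y X"
proof (cases "mspace Y = {}")
  case True
  then show ?thesis
    by (simp add: isometrically_embeds_def)
next
  case False
  obtain C where C: "countable C" "C \<subseteq> mspace Y" "mtopology_of Y closure_of C = mspace Y"
    using sep by (auto simp: separable_space_def)
  with False have "C \<noteq> {}"
    by auto
  define \<phi> where "\<phi> = (\<lambda>x n. mdist Y x (from_nat_into C n))"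
  have "inj_on \<phi> (mspace Y)"
  proof (rule inj_onI)
    fix x y assume xy: "x \<in> mspace Y" "y \<in> mspace Y" "\<phi> x = \<phi> y"
    have eq: "mdist Y x c = mdist Y y c" if "c \<in> C" for c
      using that C(1) xy(3) from_nat_into_surj[of C c] by (metis \<phi>_def)
    have "mdist Y x x = mdist Y y x"
      by (rule continuous_maps_eq_on_dense[OF C(3) continuous_on_mdist continuous_on_mdist
            Hausdorff_space_euclidean]) (use xy eq in auto)
    then show "x = y"
      using xy by (metis mdist_zero)
  qed
  then obtain Z :: "(nat \<Rightarrow> real) metric" where Z: "mspace Z = \<phi> ` mspace Y" "mcomplete_of Z"
    "separable_space (mtopology_of Z)"
    "\<And>x y. x \<in> mspace Y \<Longrightarrow> y \<in> mspace Y \<Longrightarrow> mdist Z (\<phi> x) (\<phi> y) = mdist Y x y"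
    using isometric_copy[OF _ compl sep, of \<phi>] by metis
  then obtain f where "f \<in> mspace Z \<rightarrow> mspace X"
    "\<And>x y. x \<in> mspace Z \<Longrightarrow> y \<in> mspace Z \<Longrightarrow> mdist X (f x) (f y) = mdist Z x y"
    using X unfolding universal_metric_def isometrically_embeds_def by blast
  then show ?thesis
    unfolding isometrically_embeds_def using Z by (intro bexI[of _ "f \<circ> \<phi>"]) auto
qed

end

(*
  A Katetov function on a finite set of rational points can be realized in Q close to any
  point of U that almost realizes it.  Hence the restriction of an isometry of U to a finite
  subset of Q is uniformly close to an isometric map into Q.  Back and forth extends that map
  to an isometry of Q, and density of Q in U passes from finite subsets of Q to finite
  subsets of U.
*)
theory Submission
  imports Defs
begin

section \<open>Realizing Katetov functions in the rational Urysohn space, exactly and near a given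
  point\<close>

lemma rational_urysohn_extension:
  assumes "rational_urysohn_space X" "finite A" "A \<subseteq> mspace X"
    and "\<And>a. a \<in> A \<Longrightarrow> g a \<in> \<rat> \<and> (g a :: real) \<ge> 0"
    and "\<And>a b. a \<in> A \<Longrightarrow> b \<in> A \<Longrightarrow> \<bar>g a - g b\<bar> \<le> mdist X a b \<and> mdist X a b \<le> g a + g b"
  obtains z where "z \<in> mspace X" "\<And>a. a \<in> A \<Longrightarrow> mdist X z a = g a"
proof -
  have "\<exists>z\<in>mspace X. \<forall>a\<in>A. mdist X z a = g a"
    using assms by (simp add: rational_urysohn_space_def)
  then show thesis
    using that by blast
qed

lemma rational_urysohn_Rats:
  assumes "rational_urysohn_space X" "x \<in> mspace X" "y \<in> mspace X"
  shows "mdist X x y \<in> \<rat>"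
  using assms unfolding rational_urysohn_space_def by blast

text \<open>The functions \<open>g\<close> and \<open>mdist X q\<close> differ by less than
  \<open>e\<close> on \<open>A\<close>. Prescribing their maximal difference \<open>r\<close> as the
  distance to \<open>q\<close> keeps the Katetov inequalities on \<open>insert q A\<close>, and a
  point realizing the extended function lies at distance exactly \<open>r < e\<close> from
  \<open>q\<close>. The extra 0 in the maximum covers empty \<open>A\<close>.\<close>

lemma rational_urysohn_approx_extension:
  assumes X: "rational_urysohn_space X" and A: "finite A" "A \<subseteq> mspace X" and q: "q \<in> mspace X"
    and gA: "\<And>a. a \<in> A \<Longrightarrow> g a \<in> \<rat> \<and> g a \<ge> 0"
    and gg: "\<And>a b. a \<in> A \<Longrightarrow> b \<in> A \<Longrightarrow> \<bar>g a - g b\<bar> \<le> mdist X a b \<and> mdist X a b \<le> g a + g b"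
    and close: "\<And>a. a \<in> A \<Longrightarrow> \<bar>mdist X q a - g a\<bar> < e" and e: "(0::real) < e"
  obtains z where "z \<in> mspace X" "\<And>a. a \<in> A \<Longrightarrow> mdist X z a = g a" "mdist X z q < e"
proof -
  define h where "h = (\<lambda>a. \<bar>mdist X q a - g a\<bar>)"
  \<comment> \<open>the least value at \<open>q\<close> that extends the Katetov function \<open>g\<close>; being attained, it is rational\<close>
  define r where "r = Max (insert 0 (h ` A))"
  have fin: "finite (insert 0 (h ` A))"
    using A by simp
  have hr: "h a \<le> r" if "a \<in> A" for a
    using fin that by (simp add: r_def)
  have r0: "0 \<le> r"
    using fin by (simp add: r_def)
  have r_cases: "r = 0 \<or> (\<exists>a\<in>A. r = h a)"
    using Max_in[OF fin] by (auto simp: r_def)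
  have rQ: "r \<in> \<rat>"
    using r_cases gA A q rational_urysohn_Rats[OF X] by (auto simp: h_def subset_iff)
  have re: "r < e"
    using r_cases close e by (auto simp: h_def)
  \<comment> \<open>Only the half \<open>r - g a\<close> \<le> \<open>mdist X q a\<close> of the
    Katetov inequalities for the pair \<open>q\<close>, \<open>a\<close> needs work; the rest
    follows from \<open>h a\<close> \<le> \<open>r\<close>. Since \<open>r\<close> is some
    \<open>h b\<close> or 0, it suffices to bound each \<open>h b\<close>, by going from
    \<open>q\<close> to \<open>b\<close> through \<open>a\<close>.\<close>
  have upper: "r \<le> mdist X q a + g a" if a: "a \<in> A" for a
  proof -
    have "h b \<le> mdist X q a + g a" if b: "b \<in> A" for b
    proof -
      have "mdist X q b \<le> mdist X q a + mdist X a b" "mdist X a b \<le> mdist X a q + mdist X q b"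
        using a b q A by (auto intro: mdist_triangle)
      moreover have "mdist X q a = mdist X a q"
        by (rule mdist_commute)
      ultimately show ?thesis
        using gg[OF a b] unfolding h_def by linarith
    qed
    moreover have "0 \<le> mdist X q a + g a"
      using gA[OF a] by simp
    ultimately show ?thesis
      using r_cases by auto
  qed
  define G where "G = (\<lambda>x. if x \<in> A then g x else r)"
  have qq: "mdist X q q = 0"
    using q by simp
  \<comment> \<open>If \<open>q\<close> already lies in \<open>A\<close>, its value is prescribed
    twice. The two agree: \<open>h q = g q\<close> gives one inequality and \<open>upper\<close> at
    \<open>q\<close> the other.\<close>
  have qA: "g q = r" if "q \<in> A"
    using hr[OF that] upper[OF that] gA[OF that] qq unfolding h_def by linarith
  have Gq: "G q = r" and GA: "\<And>a. a \<in> A \<Longrightarrow> G a = g a"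
    using qA by (auto simp: G_def)
  have *: "\<bar>g a - r\<bar> \<le> mdist X q a \<and> mdist X q a \<le> g a + r" if "a \<in> A" for a
    using hr[OF that] upper[OF that] unfolding h_def by linarith
  obtain z where z: "z \<in> mspace X" "\<And>a. a \<in> insert q A \<Longrightarrow> mdist X z a = G a"
  proof (rule rational_urysohn_extension[OF X, of "insert q A" G])
    show "G a \<in> \<rat> \<and> 0 \<le> G a" if "a \<in> insert q A" for a
      using that Gq GA gA rQ r0 by auto
    show "\<bar>G a - G b\<bar> \<le> mdist X a b \<and> mdist X a b \<le> G a + G b"
      if "a \<in> insert q A" "b \<in> insert q A" for a b
    proof (cases "a \<in> A"; cases "b \<in> A")
      assume "a \<in> A" "b \<in> A" then show ?thesis using gg GA by simp
    next
      assume "a \<in> A" "b \<notin> A" then show ?thesis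
        using that * Gq GA by (auto simp: mdist_commute)
    next
      assume "a \<notin> A" "b \<in> A" then show ?thesis
        using that *[of b] Gq GA by auto
    next
      assume "a \<notin> A" "b \<notin> A"
      then have "a = q" "b = q"
        using that by auto
      then show ?thesis
        using Gq r0 qq by simp
    qed
  qed (use A q in auto)
  show thesis
    using that[of z] z GA Gq re by simp
qed

section \<open>Approximating an isometry of \<open>U\<close> on a finite subset of
  \<open>Q\<close>\<close>

lemma dense_mdist:
  assumes "mtopology_of X closure_of S = mspace X" "x \<in> mspace X" "0 < e"
  obtains s where "s \<in> S" "s \<in> mspace X" "mdist X x s < e"
proof -
  interpret Metric_space "mspace X" "mdist X"
    by simp
  have "x \<in> mtopology closure_of S"
    using assms by (simp add: mtopology_of_def)
  then obtain y where "y \<in> S" "y \<in> mball x e"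
    using assms(3) unfolding metric_closure_of by blast
  then show thesis
    using that by auto
qed

text \<open>Points are added one at a time: the distances from the new point \<open>a\<close> to the
  old ones are carried over by \<open>b\<close> and realized exactly, near a point of
  \<open>Q\<close> close to \<open>\<phi> a\<close>. Errors grow at each step, so \<open>e\<close>
  is kept arbitrary in the induction.\<close>

lemma approx_by_rational_partial_isometry:
  assumes Q: "Q \<subseteq> mspace U" "rational_urysohn_space (submetric U Q)"
    and dense: "mtopology_of U closure_of Q = mspace U" and \<phi>: "\<phi> \<in> isometries U"
    and "finite A" "A \<subseteq> Q" "0 < e"
  shows "\<exists>b \<in> A \<rightarrow> Q. (\<forall>x\<in>A. \<forall>y\<in>A. mdist U (b x) (b y) = mdist U x y) \<and>
    (\<forall>x\<in>A. mdist U (b x) (\<phi> x) < e)"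
  using \<open>finite A\<close> \<open>A \<subseteq> Q\<close> \<open>0 < e\<close>
proof (induction A arbitrary: e rule: finite_induct)
  case empty
  then show ?case by simp
next
  case (insert a A)
  have \<phi>U: "\<phi> x \<in> mspace U" if "x \<in> mspace U" for x
    using \<phi> that by (auto simp: isometries_def dest: Bij_imp_funcset)
  have \<phi>d: "mdist U (\<phi> x) (\<phi> y) = mdist U x y" if "x \<in> mspace U" "y \<in> mspace U" for x y
    using \<phi> that by (auto simp: isometries_def)
  have S: "mspace (submetric U Q) = Q"
    using Q by auto
  \<comment> \<open>Error budget: \<open>e / 2\<close> for the old points and \<open>e / 4\<close>
    from \<open>\<phi> a\<close> to \<open>q\<close> make \<open>q\<close> realize the wanted
    distances up to \<open>3 * e / 4\<close>. Then \<open>z\<close> is within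
    \<open>3 * e / 4\<close> of \<open>q\<close>, hence within \<open>e\<close> of
    \<open>\<phi> a\<close>.\<close>
  from insert.prems have "A \<subseteq> Q" "a \<in> Q" "0 < e / 2" "0 < e / 4"
    by auto
  with insert.IH obtain b where b: "b \<in> A \<rightarrow> Q"
    "\<And>x y. x \<in> A \<Longrightarrow> y \<in> A \<Longrightarrow> mdist U (b x) (b y) = mdist U x y"
    "\<And>x. x \<in> A \<Longrightarrow> mdist U (b x) (\<phi> x) < e / 2"
    by metis
  have AU: "x \<in> A \<Longrightarrow> x \<in> mspace U" "x \<in> A \<Longrightarrow> b x \<in> Q" "x \<in> A \<Longrightarrow> b x \<in> mspace U" for x
    using \<open>A \<subseteq> Q\<close> Q b by auto
  have aU: "a \<in> mspace U"
    using Q \<open>a \<in> Q\<close> by auto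
  obtain q where q: "q \<in> Q" "q \<in> mspace U" "mdist U (\<phi> a) q < e / 4"
    using dense_mdist[OF dense \<phi>U[OF aU] \<open>0 < e / 4\<close>] by metis
  have "inj_on b A"
  proof (rule inj_onI)
    fix x y assume "x \<in> A" "y \<in> A" "b x = b y"
    then have "mdist U x y = 0"
      using b(2)[of x y] AU(3) by (metis mdist_zero)
    then show "x = y"
      using \<open>x \<in> A\<close> \<open>y \<in> A\<close> AU(1) by simp
  qed
  then have inv: "inv_into A b (b x) = x" if "x \<in> A" for x
    using that by simp
  let ?g = "\<lambda>y. mdist U a (inv_into A b y)"
  obtain z where "z \<in> mspace (submetric U Q)"
    "\<And>y. y \<in> b ` A \<Longrightarrow> mdist (submetric U Q) z y = ?g y" "mdist (submetric U Q) z q < 3 * e / 4"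
  proof (rule rational_urysohn_approx_extension[OF Q(2), of "b ` A" q ?g "3 * e / 4"])
    show "b ` A \<subseteq> mspace (submetric U Q)" "q \<in> mspace (submetric U Q)" "0 < 3 * e / 4"
      "finite (b ` A)"
      using AU q S \<open>0 < e / 2\<close> insert.hyps by auto
    show "?g y \<in> \<rat> \<and> 0 \<le> ?g y" if y: "y \<in> b ` A" for y
    proof -
      obtain x where x: "x \<in> A" "y = b x"
        using y by auto
      have "mdist (submetric U Q) a x \<in> \<rat>"
        by (rule rational_urysohn_Rats[OF Q(2)]) (use x S \<open>a \<in> Q\<close> \<open>A \<subseteq> Q\<close> in auto)
      then show ?thesis
        using x inv by simp
    qed
    show "\<bar>?g y - ?g y'\<bar> \<le> mdist (submetric U Q) y y' \<and> mdist (submetric U Q) y y' \<le> ?g y + ?g y'"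
      if y: "y \<in> b ` A" "y' \<in> b ` A" for y y'
    proof -
      obtain x x' where x: "x \<in> A" "x' \<in> A" "y = b x" "y' = b x'"
        using y by auto
      have "mdist U a x \<le> mdist U a x' + mdist U x' x" "mdist U a x' \<le> mdist U a x + mdist U x x'"
        "mdist U x x' \<le> mdist U x a + mdist U a x'"
        using x AU aU by (auto intro: mdist_triangle)
      then show ?thesis
        using x inv b(2)[of x x'] mdist_commute[of U x x'] mdist_commute[of U x a] by simp
    qed
    show "\<bar>mdist (submetric U Q) q y - ?g y\<bar> < 3 * e / 4" if y: "y \<in> b ` A" for y
    proof -
      obtain x where x: "x \<in> A" "y = b x"
        using y by auto
      note m = AU(1,3)[OF x(1)] \<phi>U[OF AU(1)[OF x(1)]] \<phi>U[OF aU] q(2)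
      \<comment> \<open>The distance from \<open>a\<close> to \<open>x\<close> equals that from
        \<open>\<phi> a\<close> to \<open>\<phi> x\<close>. Moving these endpoints to
        \<open>q\<close> and \<open>b x\<close> changes it by less than \<open>e / 4\<close> and
        \<open>e / 2\<close>.\<close>
      have "mdist U q (b x) \<le> mdist U q (\<phi> a) + mdist U (\<phi> a) (b x)"
        "mdist U (\<phi> a) (b x) \<le> mdist U (\<phi> a) (\<phi> x) + mdist U (\<phi> x) (b x)"
        "mdist U (\<phi> a) (\<phi> x) \<le> mdist U (\<phi> a) q + mdist U q (\<phi> x)"
        "mdist U q (\<phi> x) \<le> mdist U q (b x) + mdist U (b x) (\<phi> x)"
        using m by (auto intro: mdist_triangle)
      then have "\<bar>mdist U q (b x) - mdist U a x\<bar> < 3 * e / 4"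
        using b(3)[OF x(1)] q(3) \<phi>d[OF aU m(1)] mdist_commute[of U q "\<phi> a"]
          mdist_commute[of U "\<phi> x" "b x"] by linarith
      then show ?thesis
        using x inv by simp
    qed
  qed auto
  then have z: "z \<in> Q" "\<And>x. x \<in> A \<Longrightarrow> mdist U z (b x) = mdist U a x" "mdist U z q < 3 * e / 4"
    using inv by auto
  have zU: "z \<in> mspace U"
    using z Q by auto
  have "mdist U z (\<phi> a) \<le> mdist U z q + mdist U q (\<phi> a)"
    using zU q \<phi>U aU by (auto intro: mdist_triangle)
  then have za: "mdist U z (\<phi> a) < e"
    using z(3) q(3) mdist_commute[of U q "\<phi> a"] by simp
  have be: "mdist U (b x) (\<phi> x) < e" if "x \<in> A" for x
    using b(3)[OF that] \<open>0 < e / 2\<close> by simp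
  have zA: "mdist U (b x) z = mdist U x a" if "x \<in> A" for x
    using z(2)[OF that] by (simp add: mdist_commute)
  have zz: "mdist U z z = mdist U a a"
    using zU aU by (metis mdist_zero)
  show ?case
  proof (intro bexI[of _ "b(a := z)"] conjI ballI)
    show "b(a := z) \<in> insert a A \<rightarrow> Q"
      using b(1) z(1) by auto
    show "mdist U ((b(a := z)) x) ((b(a := z)) y) = mdist U x y"
      if "x \<in> insert a A" "y \<in> insert a A" for x y
      using that b(2) z(2) zA zz by auto
    show "mdist U ((b(a := z)) x) (\<phi> x) < e" if "x \<in> insert a A" for x
      using that be za by auto
  qed
qed

section \<open>Back and forth in the rational Urysohn space\<close>

text \<open>Relations rather than maps, so that the converse exchanges domain and range and one
  extension lemma serves both directions. Single-valuedness and injectivity follow from equality of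
  distances, since points at distance 0 coincide.\<close>

definition partial_isometry_rel :: "'a metric \<Rightarrow> ('a \<times> 'a) set \<Rightarrow> bool"
  where "partial_isometry_rel X R \<longleftrightarrow> R \<subseteq> mspace X \<times> mspace X \<and>
    (\<forall>(x,y)\<in>R. \<forall>(x',y')\<in>R. mdist X x x' = mdist X y y')"

lemma partial_isometry_relD:
  assumes "partial_isometry_rel X R" "(x, y) \<in> R"
  shows "x \<in> mspace X" "y \<in> mspace X" "(x', y') \<in> R \<Longrightarrow> mdist X x x' = mdist X y y'"
  using assms unfolding partial_isometry_rel_def by auto

lemma partial_isometry_rel_converse:
  "partial_isometry_rel X (R\<inverse>) \<longleftrightarrow> partial_isometry_rel X R"
proof -
  have "partial_isometry_rel X (S\<inverse>)" if "partial_isometry_rel X S" for S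
    using partial_isometry_relD[OF that] unfolding partial_isometry_rel_def by auto
  from this[of R] this[of "R\<inverse>"] show ?thesis
    by auto
qed

text \<open>The distances from \<open>x\<close> to \<open>Domain R\<close>, carried along
  \<open>R\<close>, form a rational Katetov function on \<open>Range R\<close>; any point realizing
  it can serve as the image of \<open>x\<close>.\<close>

lemma partial_isometry_rel_extend:
  assumes X: "rational_urysohn_space X" and R: "partial_isometry_rel X R" "finite R"
    and x: "x \<in> mspace X"
  obtains y where "partial_isometry_rel X (insert (x, y) R)"
proof -
  note D = partial_isometry_relD[OF R(1)]
  \<comment> \<open>The choice is harmless: two preimages of the same \<open>b\<close> are at
    distance 0.\<close>
  define g where "g = (\<lambda>b. mdist X x (SOME a. (a, b) \<in> R))"
  have g: "g b = mdist X x a" if ab: "(a, b) \<in> R" for a b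
  proof -
    have "(SOME a. (a, b) \<in> R, b) \<in> R"
      using ab by (rule someI)
    then have "(SOME a. (a, b) \<in> R) = a"
      using D[OF ab] D[of "SOME a. (a, b) \<in> R" b] ab by (metis mdist_zero)
    then show ?thesis
      by (simp add: g_def)
  qed
  obtain y where y: "y \<in> mspace X" "\<And>b. b \<in> Range R \<Longrightarrow> mdist X y b = g b"
  proof (rule rational_urysohn_extension[OF X, of "Range R" g])
    show "finite (Range R)" "Range R \<subseteq> mspace X"
      using R D by (auto simp: finite_Range)
    show "g b \<in> \<rat> \<and> 0 \<le> g b" if "b \<in> Range R" for b
      using that g D rational_urysohn_Rats[OF X x] by auto
    show "\<bar>g b - g b'\<bar> \<le> mdist X b b' \<and> mdist X b b' \<le> g b + g b'"
      if bb': "b \<in> Range R" "b' \<in> Range R" for b b'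
    proof -
      obtain a a' where a: "(a, b) \<in> R" "(a', b') \<in> R"
        using bb' by auto
      have "mdist X x a \<le> mdist X x a' + mdist X a' a" "mdist X x a' \<le> mdist X x a + mdist X a a'"
        "mdist X a a' \<le> mdist X a x + mdist X x a'"
        using D(1)[OF a(1)] D(1)[OF a(2)] x by (auto intro: mdist_triangle)
      then show ?thesis
        using D(3)[OF a] a g mdist_commute[of X a a'] mdist_commute[of X a x] by simp
    qed
  qed auto
  have *: "mdist X x a = mdist X y b" if "(a, b) \<in> R" for a b
    using y(2)[of b] g[OF that] RangeI[OF that] by simp
  then have "mdist X a x = mdist X b y" if "(a, b) \<in> R" for a b
    using that by (metis mdist_commute)
  moreover have "mdist X x x = mdist X y y"
    using x y(1) by (metis mdist_zero)
  ultimately have "partial_isometry_rel X (insert (x, y) R)"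
    using * R(1) x y(1) unfolding partial_isometry_rel_def by auto
  then show thesis
    by (rule that)
qed

text \<open>Forth: extend \<open>R\<close> at \<open>x\<close>. Back: extend the converse of the
  result at \<open>x\<close>, then turn it around again.\<close>

lemma partial_isometry_rel_back_forth:
  assumes X: "rational_urysohn_space X" and R: "partial_isometry_rel X R" "finite R"
    and x: "x \<in> mspace X"
  obtains R' where "partial_isometry_rel X R'" "finite R'" "R \<subseteq> R'" "x \<in> Domain R'" "x \<in> Range R'"
proof -
  obtain y where y: "partial_isometry_rel X (insert (x, y) R)"
    using partial_isometry_rel_extend[OF assms] .
  then have "partial_isometry_rel X ((insert (x, y) R)\<inverse>)" "finite ((insert (x, y) R)\<inverse>)"
    using R by (simp_all only: partial_isometry_rel_converse finite_converse finite_insert)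
  then obtain z where "partial_isometry_rel X (insert (x, z) ((insert (x, y) R)\<inverse>))"
    using partial_isometry_rel_extend[OF X _ _ x] by metis
  moreover have "insert (x, z) ((insert (x, y) R)\<inverse>) = (insert (z, x) (insert (x, y) R))\<inverse>"
    by auto
  ultimately have "partial_isometry_rel X (insert (z, x) (insert (x, y) R))"
    by (simp only: partial_isometry_rel_converse)
  then show thesis
    using that R(2) by blast
qed

lemma total_partial_isometry_rel:
  assumes R: "partial_isometry_rel X R" and dom: "mspace X \<subseteq> Domain R" and ran: "mspace X \<subseteq> Range R"
  obtains f where "f \<in> isometries X" "\<And>x y. (x, y) \<in> R \<Longrightarrow> f x = y"
proof -
  note D = partial_isometry_relD[OF R]
  have un: "y = y'" if "(x, y) \<in> R" "(x, y') \<in> R" for x y y'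
    using D[OF that(1)] D[OF that(2)] that by (metis mdist_zero)
  have inj: "x = x'" if "(x, y) \<in> R" "(x', y) \<in> R" for x x' y
    using D[OF that(1)] D[OF that(2)] that by (metis mdist_zero)
  define f where "f = (\<lambda>x\<in>mspace X. THE y. (x, y) \<in> R)"
  have f: "f x = y" if "(x, y) \<in> R" for x y
    using that un D by (auto simp: f_def)
  have fR: "(x, f x) \<in> R" if "x \<in> mspace X" for x
    using that dom f by blast
  have "bij_betw f (mspace X) (mspace X)"
    unfolding bij_betw_def
  proof
    show "inj_on f (mspace X)"
      by (rule inj_onI) (metis fR inj)
    show "f ` mspace X = mspace X"
    proof
      show "f ` mspace X \<subseteq> mspace X"
        using D(2)[OF fR] by blast
      show "mspace X \<subseteq> f ` mspace X"
      proof
        fix y assume "y \<in> mspace X"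
        then obtain x where "(x, y) \<in> R"
          using ran by blast
        then show "y \<in> f ` mspace X"
          using f D(1) by blast
      qed
    qed
  qed
  moreover have "f \<in> extensional (mspace X)"
    by (simp add: f_def)
  moreover have "mdist X (f x) (f y) = mdist X x y" if "x \<in> mspace X" "y \<in> mspace X" for x y
    using D(3)[OF fR fR] that by simp
  ultimately have "f \<in> isometries X"
    by (simp add: isometries_def Bij_def)
  then show thesis
    using f that by blast
qed

text \<open>Starting from \<open>R\<close>, stage \<open>n\<close> puts the \<open>n\<close>-th
  point of an enumeration into domain and range. The union of the stages is total on both sides and
  hence the graph of an isometry.\<close>

lemma rational_urysohn_homogeneous:
  assumes X: "rational_urysohn_space X" and R: "partial_isometry_rel X R" "finite R"
  obtains f where "f \<in> isometries X" "\<And>x y. (x, y) \<in> R \<Longrightarrow> f x = y"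
proof -
  have "countable (mspace X)"
    using X by (simp add: rational_urysohn_space_def)
  \<comment> \<open>A point comes from the extension property for the empty set; an enumeration with
    range exactly \<open>mspace X\<close> requires one.\<close>
  moreover have ne: "mspace X \<noteq> {}"
    using X rational_urysohn_extension[of X "{}" "\<lambda>_. 0"] by auto
  ultimately obtain e :: "nat \<Rightarrow> 'a" where e: "range e = mspace X"
    using range_from_nat_into by metis
  \<comment> \<open>The clause for \<open>n = 0\<close> makes the chosen sequence start at
    \<open>R\<close>.\<close>
  have "\<exists>r. \<forall>n. (partial_isometry_rel X (r n) \<and> finite (r n) \<and> (n = 0 \<longrightarrow> r n = R)) \<and>
    (r n \<subseteq> r (Suc n) \<and> e n \<in> Domain (r (Suc n)) \<and> e n \<in> Range (r (Suc n)))"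
  proof (rule dependent_nat_choice)
    show "\<exists>x. partial_isometry_rel X x \<and> finite x \<and> (0 = (0::nat) \<longrightarrow> x = R)"
      using R by auto
    fix S n assume "partial_isometry_rel X S \<and> finite S \<and> (n = (0::nat) \<longrightarrow> S = R)"
    moreover have "e n \<in> mspace X"
      using e by auto
    ultimately show "\<exists>y. (partial_isometry_rel X y \<and> finite y \<and> (Suc n = 0 \<longrightarrow> y = R)) \<and>
        S \<subseteq> y \<and> e n \<in> Domain y \<and> e n \<in> Range y"
      using partial_isometry_rel_back_forth[OF X, of S "e n"] by (metis nat.distinct(1))
  qed
  then obtain r where r: "\<And>n. partial_isometry_rel X (r n) \<and> finite (r n) \<and> (n = 0 \<longrightarrow> r n = R)"
    "\<And>n. r n \<subseteq> r (Suc n) \<and> e n \<in> Domain (r (Suc n)) \<and> e n \<in> Range (r (Suc n))"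
    by blast
  have mono: "r m \<subseteq> r n" if "m \<le> n" for m n
    using lift_Suc_mono_le[of r m n] r(2) that by blast
  have "partial_isometry_rel X (\<Union>n. r n)"
    unfolding partial_isometry_rel_def
  proof safe
    fix n x y assume "(x, y) \<in> r n"
    then show "x \<in> mspace X" "y \<in> mspace X"
      using r(1) partial_isometry_relD by metis+
  next
    \<comment> \<open>The stages increase, so both pairs lie in a common one.\<close>
    fix n m x y x' y' assume "(x, y) \<in> r n" "(x', y') \<in> r m"
    then have "(x, y) \<in> r (max n m)" "(x', y') \<in> r (max n m)"
      using mono[of n "max n m"] mono[of m "max n m"] by auto
    then show "mdist X x x' = mdist X y y'"
      using r(1) partial_isometry_relD(3) by metis
  qed
  moreover have "e n \<in> Domain (\<Union>n. r n)" "e n \<in> Range (\<Union>n. r n)" for n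
    using r(2)[of n] by blast+
  then have "mspace X \<subseteq> Domain (\<Union>n. r n)" "mspace X \<subseteq> Range (\<Union>n. r n)"
    unfolding e[symmetric] by (auto simp del: Domain_Union Range_Union)
  ultimately obtain f where f: "f \<in> isometries X" "\<And>x y. (x, y) \<in> (\<Union>n. r n) \<Longrightarrow> f x = y"
    using total_partial_isometry_rel by metis
  have "R \<subseteq> (\<Union>n. r n)"
    using r(1)[of 0] by blast
  then show thesis
    using that[OF f(1) f(2)] by (simp add: subset_iff)
qed

section \<open>Finite approximation in the weak topology and the density of the extended
  isometries\<close>

text \<open>A basic open set of the product restricts only finitely many coordinates, so one
  positive tolerance on a finite set suffices to enter it.\<close>

lemma weak_topology_closureI:
  assumes \<phi>: "\<phi> \<in> isometries X" and S: "S \<subseteq> isometries X"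
    and approx: "\<And>F e. finite F \<Longrightarrow> F \<subseteq> mspace X \<Longrightarrow> 0 < e \<Longrightarrow>
      \<exists>\<psi>\<in>S. \<forall>x\<in>F. mdist X (\<psi> x) (\<phi> x) < e"
  shows "\<phi> \<in> weak_topology X closure_of S"
proof -
  interpret Metric_space "mspace X" "mdist X"
    by simp
  have maps: "f \<in> mspace X \<rightarrow>\<^sub>E mspace X" if "f \<in> isometries X" for f
    using that by (auto simp: isometries_def Bij_def bij_betw_def PiE_def)
  have "\<exists>\<psi>\<in>S. \<psi> \<in> T" if T: "\<phi> \<in> T" "openin (weak_topology X) T" for T
  proof -
    have "\<exists>V. openin (product_topology (\<lambda>_. mtopology) (mspace X)) V \<and> T = V \<inter> isometries X"
      using T(2) unfolding weak_topology_def openin_subtopology mtopology_of_def carrier_Aut .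
    then obtain V where V: "openin (product_topology (\<lambda>_. mtopology) (mspace X)) V"
      "T = V \<inter> isometries X"
      by iprover
    have "\<phi> \<in> V"
      using T(1) V(2) by simp
    then have "\<exists>W. finite {x \<in> mspace X. W x \<noteq> topspace mtopology} \<and>
        (\<forall>x\<in>mspace X. openin mtopology (W x)) \<and> \<phi> \<in> Pi\<^sub>E (mspace X) W \<and> Pi\<^sub>E (mspace X) W \<subseteq> V"
      by (rule bspec[OF V(1)[unfolded openin_product_topology_alt]])
    then obtain W where W: "finite {x \<in> mspace X. W x \<noteq> topspace mtopology}"
      "\<And>x. x \<in> mspace X \<Longrightarrow> openin mtopology (W x)" "\<phi> \<in> Pi\<^sub>E (mspace X) W" "Pi\<^sub>E (mspace X) W \<subseteq> V"
      by (elim exE conjE) simp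
    let ?F = "{x \<in> mspace X. W x \<noteq> topspace mtopology}"
    have "\<exists>e>0. mball (\<phi> x) e \<subseteq> W x" if "x \<in> ?F" for x
      using W(2)[of x] W(3) that unfolding openin_mtopology by auto
    then obtain e where e: "\<And>x. x \<in> ?F \<Longrightarrow> 0 < e x \<and> mball (\<phi> x) (e x) \<subseteq> W x"
      by metis
    \<comment> \<open>The inserted 1 keeps the minimum defined and positive when no coordinate is
      restricted.\<close>
    define d where "d = Min (insert 1 (e ` ?F))"
    have "0 < d" and de: "\<And>x. x \<in> ?F \<Longrightarrow> d \<le> e x"
      using W(1) e by (auto simp: d_def)
    obtain \<psi> where \<psi>: "\<psi> \<in> S" "\<And>x. x \<in> ?F \<Longrightarrow> mdist X (\<psi> x) (\<phi> x) < d"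
      using approx[OF W(1) _ \<open>0 < d\<close>] by blast
    have \<psi>i: "\<psi> \<in> isometries X"
      using \<psi> S by auto
    have "\<psi> x \<in> W x" if x: "x \<in> mspace X" for x
    proof (cases "x \<in> ?F")
      case True
      have "\<psi> x \<in> mball (\<phi> x) (e x)"
        using \<psi>(2)[OF True] de[OF True] maps[OF \<phi>] maps[OF \<psi>i] x
        by (auto simp: mdist_commute)
      then show ?thesis
        using e[OF True] by blast
    next
      case False
      then show ?thesis
        using x maps[OF \<psi>i] by auto
    qed
    then have "\<psi> \<in> Pi\<^sub>E (mspace X) W"
      using maps[OF \<psi>i] by (auto simp: PiE_def)
    then show ?thesis
      using \<psi>(1) \<psi>i V W(4) by blast
  qed
  then show ?thesis
    using \<phi> by (auto simp: in_closure_of topspace_weak_topology)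
qed

theorem theorem1:
  fixes U :: "'a metric" and Q :: "'a set"
  assumes "urysohn_space U"
    and "Q \<subseteq> mspace U" and "rational_urysohn_space (submetric U Q)"
    and "mtopology_of U closure_of Q = mspace U"
  shows "weak_topology U closure_of (extend_isometry U Q ` carrier (Aut (submetric U Q)))
    = carrier (Aut U)"
proof
  show "weak_topology U closure_of (extend_isometry U Q ` carrier (Aut (submetric U Q)))
      \<subseteq> carrier (Aut U)"
    using closure_of_subset_topspace topspace_weak_topology by metis
  have compl: "mcomplete_of U"
    using assms(1) by (simp add: urysohn_space_def)
  note ext = extend_isometry[OF compl assms(4,2)]
  have S: "mspace (submetric U Q) = Q"
    using assms(2) by auto
  show "carrier (Aut U)
      \<subseteq> weak_topology U closure_of (extend_isometry U Q ` carrier (Aut (submetric U Q)))"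
  proof
    fix \<phi> assume "\<phi> \<in> carrier (Aut U)"
    then have \<phi>: "\<phi> \<in> isometries U"
      by simp
    have maps: "f x \<in> mspace U" if "f \<in> isometries U" "x \<in> mspace U" for f x
      using that by (auto simp: isometries_def dest: Bij_imp_funcset)
    have iso: "mdist U (f x) (f y) = mdist U x y"
      if "f \<in> isometries U" "x \<in> mspace U" "y \<in> mspace U" for f x y
      using that by (auto simp: isometries_def)
    show "\<phi> \<in> weak_topology U closure_of (extend_isometry U Q ` carrier (Aut (submetric U Q)))"
    proof (rule weak_topology_closureI[OF \<phi>])
      show "extend_isometry U Q ` carrier (Aut (submetric U Q)) \<subseteq> isometries U"
        using ext(1) by auto
      fix F and e :: real assume F: "finite F" "F \<subseteq> mspace U" and e: "0 < e"
      \<comment> \<open>Each point of \<open>F\<close> is replaced by a nearby \<open>q x\<close> in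
        \<open>Q\<close>, where the partial isometry \<open>b\<close> can be built. The three thirds
        of \<open>e\<close> bound the way from \<open>?\<psi> x\<close> through
        \<open>?\<psi> (q x)\<close> and \<open>\<phi> (q x)\<close> to
        \<open>\<phi> x\<close>.\<close>
      then have "\<exists>s. s \<in> Q \<and> mdist U x s < e / 3" if "x \<in> F" for x
        using dense_mdist[OF assms(4), of x "e / 3"] that by (metis subsetD zero_less_divide_iff zero_less_numeral)
      then obtain q where q: "\<And>x. x \<in> F \<Longrightarrow> q x \<in> Q \<and> mdist U x (q x) < e / 3"
        by metis
      obtain b where b: "b \<in> q ` F \<rightarrow> Q"
        "\<forall>x\<in>q ` F. \<forall>y\<in>q ` F. mdist U (b x) (b y) = mdist U x y"
        "\<forall>x\<in>q ` F. mdist U (b x) (\<phi> x) < e / 3"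
      proof -
        have "finite (q ` F)" "q ` F \<subseteq> Q" "0 < e / 3"
          using F q e by auto
        from approx_by_rational_partial_isometry[OF assms(2-4) \<phi> this] show thesis
          by (elim bexE conjE) (rule that)
      qed
      let ?R = "(\<lambda>x. (x, b x)) ` q ` F"
      have "q x \<in> Q" "b (q x) \<in> Q" if "x \<in> F" for x
        using q[OF that] b(1) that by auto
      then have "?R \<subseteq> Q \<times> Q"
        by auto
      moreover have "\<forall>(x,y)\<in>?R. \<forall>(x',y')\<in>?R. mdist U x x' = mdist U y y'"
        using b(2) by simp
      ultimately have R: "partial_isometry_rel (submetric U Q) ?R"
        unfolding partial_isometry_rel_def S by simp
      obtain f where f: "f \<in> isometries (submetric U Q)" "\<And>x y. (x, y) \<in> ?R \<Longrightarrow> f x = y"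
        by (rule rational_urysohn_homogeneous[OF assms(3) R]) (use F(1) in auto)
      let ?\<psi> = "extend_isometry U Q f"
      have "mdist U (?\<psi> x) (\<phi> x) < e" if x: "x \<in> F" for x
      proof -
        have m: "x \<in> mspace U" "q x \<in> mspace U" "q x \<in> Q"
          using x F q assms(2) by auto
        have "?\<psi> (q x) = b (q x)"
          using ext(2)[OF f(1) m(3)] f(2) x by auto
        then have "mdist U (?\<psi> (q x)) (\<phi> (q x)) < e / 3"
          using b(3) x by simp
        moreover have "mdist U (?\<psi> x) (\<phi> x) \<le> mdist U (?\<psi> x) (?\<psi> (q x)) + mdist U (?\<psi> (q x)) (\<phi> x)"
          "mdist U (?\<psi> (q x)) (\<phi> x) \<le> mdist U (?\<psi> (q x)) (\<phi> (q x)) + mdist U (\<phi> (q x)) (\<phi> x)"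
          using m maps \<phi> ext(1)[OF f(1)] by (auto intro!: mdist_triangle)
        \<comment> \<open>Both maps are isometries of \<open>U\<close>, so each distance equals that
          between \<open>x\<close> and \<open>q x\<close>.\<close>
        moreover have "mdist U (?\<psi> x) (?\<psi> (q x)) < e / 3" "mdist U (\<phi> (q x)) (\<phi> x) < e / 3"
          using iso[OF ext(1)[OF f(1)] m(1,2)] iso[OF \<phi> m(2,1)] q[OF x]
          by (auto simp: mdist_commute)
        ultimately show ?thesis
          by linarith
      qed
      then show "\<exists>\<psi>\<in>extend_isometry U Q ` carrier (Aut (submetric U Q)).
          \<forall>x\<in>F. mdist U (\<psi> x) (\<phi> x) < e"
        using f(1) by auto
    qed
  qed
qed

end
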